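(* Let $k$ be a positive integer, let $s,t\geq 1$ be integers and let $n\geq k$. Then \[ ex_{bip}(n,K_{s,t},M_{k+1})=\begin{cases} \binom{k}{s}\binom{n}{t}+\binom{k}{t}\binom{n}{s}, & s\neq t,\\[4pt] \binom{k}{s}\binom{n}{s}, & s=t. \end{cases} \]
   Context: All graphs are simple. $M_{k+1}$ denotes a matching with $k+1$ edges and $K_{s,t}$ the complete bipartite graph with parts of sizes $s$ and $t$. For graphs $T$ and $F$, $ex_{bip}(n,T,F)$ denotes the maximum possible number of copies of $T$ (subgraphs isomorphic to $T$) in a bipartite graph with bipartition classes each of size $n$ that contains no subgraph isomorphic to $F$. Binomial coefficients $\binom{a}{b}$ are $0$ when $b>a$. *)

theory Defs
  imports "Graph_Theory.Graph_Theory"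
begin

text \<open>As in \<^theory>\<open>Graph_Theory.Kuratowski\<close>, a simple graph is a finite symmetric loopless
  digraph without parallel arcs (\<^const>\<open>pair_graph\<close>): the edge \<open>uv\<close> is represented by the two arcs
  \<open>(u,v)\<close> and \<open>(v,u)\<close>.\<close>

definition complete_bip :: "nat \<Rightarrow> nat \<Rightarrow> (nat + nat) pair_pre_digraph" where
  "complete_bip s t =
     (let U = Inl ` {..<s}; V = Inr ` {..<t}
      in \<lparr>pverts = U \<union> V, parcs = U \<times> V \<union> V \<times> U\<rparr>)"

text \<open>\<open>matching_graph m\<close> is \<open>M\<^sub>m\<close>: it has \<open>m\<close> pairwise disjoint edges, the \<open>i\<close>-th one joining
  \<open>(i,False)\<close> and \<open>(i,True)\<close>, and no isolated vertices.\<close>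

definition matching_graph :: "nat \<Rightarrow> (nat \<times> bool) pair_pre_digraph" where
  "matching_graph m =
     \<lparr>pverts = {..<m} \<times> UNIV, parcs = {((i, b), (i, \<not> b)) | i b. i < m}\<rparr>"

text \<open>Copies are counted as (not necessarily induced) subgraphs, not as embeddings. If \<open>T\<close> is a
  simple graph, then so is every copy, since isomorphisms preserve symmetry.\<close>

definition copies :: "'b pair_pre_digraph \<Rightarrow> 'a pair_pre_digraph \<Rightarrow> 'a pair_pre_digraph set" where
  "copies T G =
     {H. subgraph (with_proj H) (with_proj G) \<and> digraph_iso (with_proj T) (with_proj H)}"

definition balanced_bipartite :: "nat \<Rightarrow> 'a pair_pre_digraph \<Rightarrow> bool" where
  "balanced_bipartite n G \<longleftrightarrow> pair_graph G \<and>
     (\<exists>A B. pverts G = A \<union> B \<and> A \<inter> B = {} \<and> card A = n \<and> card B = n \<and>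
            parcs G \<subseteq> A \<times> B \<union> B \<times> A)"

text \<open>The host graphs have natural numbers as vertices; this is no restriction because every finite
  graph is isomorphic to such a graph.\<close>

definition ex_bip :: "nat \<Rightarrow> 'b pair_pre_digraph \<Rightarrow> 'c pair_pre_digraph \<Rightarrow> nat" where
  "ex_bip n T F =
     Max {card (copies T G) | G :: nat pair_pre_digraph.
            balanced_bipartite n G \<and> copies F G = {}}"

lemma complete_bip_is_complete_bipartite:
  "complete_bipartite_digraph s t (with_proj (complete_bip s t))"
proof -
  have "Inl ` {..<s} \<inter> Inr ` {..<t} = {}" "card (Inl ` {..<s} :: (nat + nat) set) = s"
    "card (Inr ` {..<t} :: (nat + nat) set) = t"
    by (auto simp: card_image)
  then show ?thesis
    unfolding complete_bipartite_digraph_pair_def complete_bip_def Let_def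
    by (intro conjI exI[of _ "Inl ` {..<s}"] exI[of _ "Inr ` {..<t}"]) simp_all
qed

lemma pair_graph_matching_graph: "pair_graph (matching_graph m)"
proof -
  have "parcs (matching_graph m) \<subseteq> ({..<m} \<times> UNIV) \<times> ({..<m} \<times> UNIV)"
    by (auto simp: matching_graph_def)
  then have "finite (parcs (matching_graph m))"
    by (rule finite_subset) simp
  then show ?thesis
    by unfold_locales (auto simp: matching_graph_def symmetric_def intro!: symI)
qed

end

theory Submission
  imports Defs
begin

text \<open>
  By Koenig's theorem a bipartite graph without \<open>M\<^bsub>k+1\<^esub>\<close> has a vertex cover consisting of
  \<open>a\<close> vertices of one class and \<open>b\<close> of the other with \<open>a + b \<le> k\<close>. A copy of \<open>K\<^bsub>s,t\<^esub>\<close> has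
  its two sides in different classes, and one of the two sides lies inside the cover, since a vertex
  outside the cover on each side would give an uncovered edge. Counting the copies by which side this is
  and using \<open>(a choose s) + (b choose s) \<le> k choose s\<close> gives the upper bound. It is attained by
  joining \<open>k\<close> vertices of one class to the whole other class.
\<close>

section \<open>Koenig's theorem for bipartite relations\<close>

text \<open>Finiteness is built in because \<open>card\<close> of an infinite set is 0, which would
  make an infinite cover look small.\<close>

definition is_cover :: "('a \<times> 'b) set \<Rightarrow> 'a set \<Rightarrow> 'b set \<Rightarrow> bool" where
  "is_cover E X Y \<longleftrightarrow> finite X \<and> finite Y \<and> E \<subseteq> X \<times> UNIV \<union> UNIV \<times> Y"

lemma card_sum_Int_Un:
  assumes "finite X1" "finite X2"
  shows "card (X1 \<union> X2) + card (X1 \<inter> X2) = card X1 + card X2"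
  using card_Un_Int[OF assms] by simp

text \<open>The covers \<open>(X1 \<inter> X2, Y1 \<union> Y2)\<close> and \<open>({a} \<union> X1 \<union> X2, Y1 \<inter> Y2)\<close> of \<open>E\<close> have total size
  at most \<open>2 m - 1\<close>, so one of them is smaller than \<open>m\<close>.\<close>

lemma cover_exchange_left:
  assumes 1: "is_cover (E - {(a, b)}) X1 Y1" "card X1 + card Y1 < m"
    and 2: "is_cover (E - {(a, b')}) X2 Y2" "card X2 + card Y2 < m"
    and ne: "b \<noteq> b'" and mem: "(a, b) \<in> E" "(a, b') \<in> E"
  shows "\<exists>X Y. is_cover E X Y \<and> card X + card Y < m"
proof (cases "is_cover E X1 Y1 \<or> is_cover E X2 Y2")
  case True
  then show ?thesis using 1(2) 2(2) by blast
next
  case False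
  have fin: "finite X1" "finite Y1" "finite X2" "finite Y2"
    using 1 2 by (auto simp: is_cover_def)
  \<comment> \<open>A cover of \<open>E\<close> minus one edge that contains an end of that edge
    covers all of \<open>E\<close>, which is excluded here.\<close>
  have "a \<notin> X1" "b \<notin> Y1" "a \<notin> X2" "b' \<notin> Y2"
    using False 1(1) 2(1) by (auto simp: is_cover_def)
  \<comment> \<open>Each of the two edges survives the deletion of the other, and \<open>a\<close>
    does not cover it, so its right end must.\<close>
  then have bb: "b \<in> Y2" "b' \<in> Y1"
    using 1(1) 2(1) ne mem by (auto simp: is_cover_def)
  \<comment> \<open>An edge with right end outside \<open>Y1 \<union> Y2\<close> is neither of the
    deleted edges, so its left end lies in both \<open>X1\<close> and \<open>X2\<close>.\<close>
  have c1: "is_cover E (X1 \<inter> X2) (Y1 \<union> Y2)"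
    using 1(1) 2(1) bb by (auto simp: is_cover_def)
  have c2: "is_cover E (insert a (X1 \<union> X2)) (Y1 \<inter> Y2)"
    using 1(1) 2(1) by (auto simp: is_cover_def)
  have "card (insert a (X1 \<union> X2)) \<le> Suc (card (X1 \<union> X2))"
    by (simp add: card_insert_if fin)
  then have "card (X1 \<inter> X2) + card (Y1 \<union> Y2) < m
      \<or> card (insert a (X1 \<union> X2)) + card (Y1 \<inter> Y2) < m"
    using card_sum_Int_Un[OF fin(1,3)] card_sum_Int_Un[OF fin(2,4)] 1(2) 2(2) by linarith
  then show ?thesis using c1 c2 by blast
qed

lemma is_cover_converse: "is_cover (E\<inverse>) X Y \<longleftrightarrow> is_cover E Y X"
  by (auto simp: is_cover_def)

text \<open>Transposing \<open>E\<close> exchanges the two classes and reduces this to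
  \<open>cover_exchange_left\<close>.\<close>

lemma cover_exchange_right:
  assumes 1: "is_cover (E - {(a, b)}) X1 Y1" "card X1 + card Y1 < m"
    and 2: "is_cover (E - {(a', b)}) X2 Y2" "card X2 + card Y2 < m"
    and ne: "a \<noteq> a'" and mem: "(a, b) \<in> E" "(a', b) \<in> E"
  shows "\<exists>X Y. is_cover E X Y \<and> card X + card Y < m"
proof -
  have "is_cover (E\<inverse> - {(b, a)}) Y1 X1" "is_cover (E\<inverse> - {(b, a')}) Y2 X2"
    using 1(1) 2(1) by (auto simp: is_cover_def)
  then have "\<exists>X Y. is_cover (E\<inverse>) X Y \<and> card X + card Y < m"
    using 1(2) 2(2) ne mem cover_exchange_left[of "E\<inverse>" b a Y1 X1 m a' Y2 X2]
    by (simp add: add.commute)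
  then show ?thesis by (metis is_cover_converse add.commute)
qed

text \<open>Edges are deleted as long as every cover still has size at least \<open>m\<close>. Once
  no deletion is possible, two edges sharing an end would yield a cover smaller than
  \<open>m\<close> by the exchange lemmas.\<close>

theorem koenig:
  assumes "finite E" "\<And>X Y. is_cover E X Y \<Longrightarrow> m \<le> card X + card Y"
  shows "\<exists>M\<subseteq>E. inj_on fst M \<and> inj_on snd M \<and> card M = m"
  using assms
proof (induction E rule: finite_psubset_induct)
  case (psubset E)
  show ?case
  proof (cases "\<exists>e\<in>E. \<forall>X Y. is_cover (E - {e}) X Y \<longrightarrow> m \<le> card X + card Y")
    case True
    then obtain e where "e \<in> E" "\<And>X Y. is_cover (E - {e}) X Y \<Longrightarrow> m \<le> card X + card Y" by blast
    then obtain M where "M \<subseteq> E - {e}" "inj_on fst M \<and> inj_on snd M \<and> card M = m"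
      using psubset.IH[of "E - {e}"] by blast
    then show ?thesis by blast
  next
    case False
    \<comment> \<open>If every edge is critical for the cover number, then \<open>E\<close> is itself a matching.\<close>
    then have crit: "\<exists>X Y. is_cover (E - {e}) X Y \<and> card X + card Y < m" if "e \<in> E" for e
      using that by (meson not_le)
    have nocov: False if "\<exists>X Y. is_cover E X Y \<and> card X + card Y < m"
      using that psubset.prems by (meson not_le)
    have inj_fst: "inj_on fst E"
    proof (rule inj_onI, rule ccontr)
      fix e e' assume e: "e \<in> E" "e' \<in> E" "fst e = fst e'" "e \<noteq> e'"
      obtain a b b' where ab: "e = (a, b)" "e' = (a, b')" "b \<noteq> b'"
        using e by (metis prod.collapse)
      obtain X1 Y1 X2 Y2 where "is_cover (E - {e}) X1 Y1" "card X1 + card Y1 < m"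
        "is_cover (E - {e'}) X2 Y2" "card X2 + card Y2 < m"
        using crit e(1,2) by meson
      with ab e show False using cover_exchange_left[of E a b X1 Y1 m b' X2 Y2] nocov by simp
    qed
    have inj_snd: "inj_on snd E"
    proof (rule inj_onI, rule ccontr)
      fix e e' assume e: "e \<in> E" "e' \<in> E" "snd e = snd e'" "e \<noteq> e'"
      obtain a a' b where ab: "e = (a, b)" "e' = (a', b)" "a \<noteq> a'"
        using e by (metis prod.collapse)
      obtain X1 Y1 X2 Y2 where "is_cover (E - {e}) X1 Y1" "card X1 + card Y1 < m"
        "is_cover (E - {e'}) X2 Y2" "card X2 + card Y2 < m"
        using crit e(1,2) by meson
      with ab e show False using cover_exchange_right[of E a b X1 Y1 m a' X2 Y2] nocov by simp
    qed
    \<comment> \<open>The left ends cover \<open>E\<close>, and by injectivity of \<open>fst\<close>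
      there are as many of them as edges.\<close>
    have "is_cover E (fst ` E) {}"
      using psubset.hyps by (force simp: is_cover_def)
    then have "m \<le> card E"
      using psubset.prems[of "fst ` E" "{}"] card_image[OF inj_fst] by simp
    then obtain M where "M \<subseteq> E" "card M = m"
      using obtain_subset_with_card_n by metis
    then show ?thesis
      using inj_on_subset[OF inj_fst] inj_on_subset[OF inj_snd] by blast
  qed
qed

section \<open>Copies of matchings and complete bipartite graphs\<close>

definition map_pair_graph :: "('a \<Rightarrow> 'b) \<Rightarrow> 'a pair_pre_digraph \<Rightarrow> 'b pair_pre_digraph" where
  "map_pair_graph f T = \<lparr>pverts = f ` pverts T, parcs = map_prod f f ` parcs T\<rparr>"

text \<open>\<open>digraph_iso\<close> involves a separate arc map. Since arcs are the pairs of
  their ends, compatibility with tails and heads forces that map to be \<open>map_prod f f\<close>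
  on the arcs.\<close>

lemma digraph_iso_with_proj_iff:
  assumes "pair_wf_digraph T"
  shows "digraph_iso (with_proj T) (with_proj H) \<longleftrightarrow>
    (\<exists>f. inj_on f (pverts T) \<and> H = map_pair_graph f T)"
proof
  assume "digraph_iso (with_proj T) (with_proj H)"
  then obtain h where h: "pre_digraph.digraph_isomorphism (with_proj T) h"
    and H: "with_proj H = app_iso h (with_proj T)"
    by (auto simp: digraph_iso_def)
  let ?f = "iso_verts h"
  have ht: "iso_tail h = fst" "iso_head h = snd" and v: "pverts H = ?f ` pverts T"
    and a: "parcs H = iso_arcs h ` parcs T"
    using H by (auto simp: with_proj_def app_iso_def)
  have "iso_arcs h e = map_prod ?f ?f e" if "e \<in> parcs T" for e
    using h that by (auto simp: pre_digraph.digraph_isomorphism_def ht prod_eq_iff)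
  then have "parcs H = map_prod ?f ?f ` parcs T"
    unfolding a by (auto intro!: image_cong)
  moreover have "inj_on ?f (pverts T)"
    using h by (auto simp: pre_digraph.digraph_isomorphism_def)
  ultimately show "\<exists>f. inj_on f (pverts T) \<and> H = map_pair_graph f T"
    using v by (auto simp: map_pair_graph_def intro!: exI[of _ ?f] pair_pre_digraph.equality)
next
  assume "\<exists>f. inj_on f (pverts T) \<and> H = map_pair_graph f T"
  then obtain f where f: "inj_on f (pverts T)" and H: "H = map_pair_graph f T" by blast
  interpret pair_wf_digraph T by fact
  define h where "h = \<lparr>iso_verts = f, iso_arcs = map_prod f f, iso_head = snd, iso_tail = fst\<rparr>"
  have "inj_on (map_prod f f) (parcs T)"
    by (rule inj_on_subset[OF map_prod_inj_on[OF f f]])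
      (auto dest: in_arcsD1 in_arcsD2)
  moreover have "wf_digraph (with_proj T)"
    using assms by (simp add: wf_digraph_wp_iff)
  ultimately have "pre_digraph.digraph_isomorphism (with_proj T) h"
    using f by (auto simp: pre_digraph.digraph_isomorphism_def h_def)
  moreover have "with_proj H = app_iso h (with_proj T)"
    by (simp add: H map_pair_graph_def h_def with_proj_def app_iso_def)
  ultimately show "digraph_iso (with_proj T) (with_proj H)"
    by (auto simp: digraph_iso_def)
qed

text \<open>Reduces copies to injective vertex maps. The well-formedness of the copy demanded by
  \<open>subgraph\<close> is automatic for an image of a well-formed graph.\<close>

lemma in_copies_iff:
  fixes T :: "'b pair_pre_digraph" and G :: "'a pair_pre_digraph"
  assumes T: "pair_wf_digraph T" and G: "pair_wf_digraph G"
  shows "H \<in> copies T G \<longleftrightarrow> (\<exists>f. inj_on f (pverts T) \<and> f ` pverts T \<subseteq> pverts G \<and>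
    map_prod f f ` parcs T \<subseteq> parcs G \<and> H = map_pair_graph f T)"
proof -
  have "pair_wf_digraph (map_pair_graph f T)" for f :: "'b \<Rightarrow> 'a"
    using T by (auto simp: pair_wf_digraph_def map_pair_graph_def)
  then show ?thesis
    using G by (auto simp: copies_def digraph_iso_with_proj_iff[OF T] subgraph_def
        wf_digraph_wp_iff map_pair_graph_def)
qed

lemma pair_graph_complete_bip: "pair_graph (complete_bip s t)"
  using complete_bip_is_complete_bipartite by (rule pair_graphI_complete_bipartite)

lemma pair_graph_imp_wf: "pair_graph G \<Longrightarrow> pair_wf_digraph G"
  by (simp add: pair_graph_def pair_digraph_def pair_fin_digraph_def)

lemma pair_graph_symD: "pair_graph G \<Longrightarrow> (x, y) \<in> parcs G \<Longrightarrow> (y, x) \<in> parcs G"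
  by (metis pair_graph.axioms(2) pair_pseudo_graph.axioms(2) pair_sym_digraph.arcs_symmetric)

section \<open>Bicliques and copies of K_{s,t}\<close>

definition biclique :: "'a set \<Rightarrow> 'a set \<Rightarrow> 'a pair_pre_digraph" where
  "biclique S T = \<lparr>pverts = S \<union> T, parcs = S \<times> T \<union> T \<times> S\<rparr>"

lemma biclique_commute: "biclique S T = biclique T S"
  by (auto simp: biclique_def)

lemma map_pair_graph_complete_bip:
  "map_pair_graph f (complete_bip s t) = biclique (f ` Inl ` {..<s}) (f ` Inr ` {..<t})"
  by (simp add: map_pair_graph_def complete_bip_def biclique_def image_Un
      map_prod_surj_on[OF refl refl])

lemma biclique_in_copies:
  assumes G: "pair_graph G" and ST: "S \<subseteq> pverts G" "T \<subseteq> pverts G" "S \<inter> T = {}" "S \<times> T \<subseteq> parcs G"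
    and card: "card S = s" "card T = t" "s \<ge> 1" "t \<ge> 1"
  shows "biclique S T \<in> copies (complete_bip s t) G"
proof -
  \<comment> \<open>Positive cardinality forces finiteness, so both sides can be enumerated.\<close>
  have "finite S" "finite T" using card by (auto intro: card_ge_0_finite)
  then obtain g h where g: "bij_betw g {..<s} S" and h: "bij_betw h {..<t} T"
    using ex_bij_betw_nat_finite[of S] ex_bij_betw_nat_finite[of T] card
    by (auto simp: atLeast0LessThan)
  let ?f = "case_sum g h"
  have img: "?f ` Inl ` {..<s} = S" "?f ` Inr ` {..<t} = T"
    using g h by (auto simp: bij_betw_def image_image)
  have eq: "g i = g j \<longleftrightarrow> i = j" if "i < s" "j < s" for i j
    using g that by (auto simp: bij_betw_def inj_on_eq_iff)
  have eq': "h i = h j \<longleftrightarrow> i = j" if "i < t" "j < t" for i j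
    using h that by (auto simp: bij_betw_def inj_on_eq_iff)
  have ne: "g i \<noteq> h j" if "i < s" "j < t" for i j
    using g h that ST(3) by (auto simp: bij_betw_def)
  have "inj_on ?f (pverts (complete_bip s t))"
    by (auto simp: complete_bip_def inj_on_def eq eq' ne ne[symmetric])
  moreover have "biclique S T = map_pair_graph ?f (complete_bip s t)"
    by (simp add: map_pair_graph_complete_bip img)
  moreover have "S \<union> T \<subseteq> pverts G" "S \<times> T \<union> T \<times> S \<subseteq> parcs G"
    using ST pair_graph_symD[OF G] by auto
  ultimately show ?thesis
    by (subst in_copies_iff[OF pair_graph_imp_wf[OF pair_graph_complete_bip] pair_graph_imp_wf[OF G]])
      (auto intro!: exI[of _ ?f] simp: map_pair_graph_def biclique_def)
qed

text \<open>Pairs are oriented by the classes of the host, since \<open>biclique S T\<close> does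
  not remember the order of its sides.\<close>

definition bicliques :: "('a \<times> 'a) set \<Rightarrow> 'a set \<Rightarrow> 'a set \<Rightarrow> nat \<Rightarrow> nat \<Rightarrow> ('a set \<times> 'a set) set" where
  "bicliques E A B s t = {(S, T). S \<subseteq> A \<and> T \<subseteq> B \<and> card S = s \<and> card T = t \<and> S \<times> T \<subseteq> E}"

lemma finite_bicliques: "finite A \<Longrightarrow> finite B \<Longrightarrow> finite (bicliques E A B s t)"
  by (rule finite_subset[of _ "Pow A \<times> Pow B"]) (auto simp: bicliques_def)

lemma bicliques_disjoint:
  "s \<noteq> t \<Longrightarrow> bicliques E A B s t \<inter> bicliques E A B t s = {}"
  by (auto simp: bicliques_def)

locale bipartite_host =
  fixes G :: "'a pair_pre_digraph" and A B :: "'a set"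
  assumes pair_graph_G: "pair_graph G"
    and verts: "pverts G = A \<union> B" "A \<inter> B = {}"
    and arcs: "parcs G \<subseteq> A \<times> B \<union> B \<times> A"
begin

lemma finite_parts: "finite A" "finite B"
  using pair_fin_digraph.pair_finite_verts[of G] pair_graph_G verts
  by (auto simp: pair_graph_def pair_digraph_def)

text \<open>K_{s,t} with nonempty sides is connected, so its sides fall into opposite classes of the
  host, in one of two orientations.\<close>

lemma copies_complete_bip:
  assumes "s \<ge> 1" "t \<ge> 1"
  shows "copies (complete_bip s t) G =
    case_prod biclique ` (bicliques (parcs G) A B s t \<union> bicliques (parcs G) A B t s)"
    (is "_ = _ ` ?P")
proof (intro equalityI subsetI)
  fix H assume "H \<in> copies (complete_bip s t) G"
  then obtain f where f: "inj_on f (pverts (complete_bip s t))"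
    "f ` pverts (complete_bip s t) \<subseteq> pverts G"
    and H: "H = map_pair_graph f (complete_bip s t)" "parcs H \<subseteq> parcs G"
    using in_copies_iff[OF pair_graph_imp_wf[OF pair_graph_complete_bip] pair_graph_imp_wf[OF pair_graph_G]]
    by (auto simp: map_pair_graph_def)
  define S where "S = f ` Inl ` {..<s}"
  define T where "T = f ` Inr ` {..<t}"
  have HST: "H = biclique S T" by (simp add: H(1) S_def T_def map_pair_graph_complete_bip)
  have cards: "card S = s" "card T = t"
    using f(1) by (auto simp: S_def T_def complete_bip_def card_image inj_on_Un)
  have sub: "S \<times> T \<subseteq> parcs G" "T \<times> S \<subseteq> parcs G"
    using H(2) by (auto simp: HST biclique_def)
  obtain x y where xy: "x \<in> S" "y \<in> T" using cards assms
    by (metis all_not_in_conv card.empty not_one_le_zero)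
  have "S \<subseteq> A \<and> T \<subseteq> B \<or> S \<subseteq> B \<and> T \<subseteq> A"
  \<comment> \<open>All of \<open>S\<close> is adjacent to \<open>y\<close>, so the class of
    \<open>y\<close> decides that of \<open>S\<close>; then \<open>x\<close> decides the class of
    \<open>T\<close>.\<close>
  proof (cases "y \<in> B")
    case True
    then have "S \<subseteq> A" using sub(1) xy arcs verts(2) by blast
    moreover then have "T \<subseteq> B" using sub(1) xy arcs verts(2) by blast
    ultimately show ?thesis by blast
  next
    case False
    then have "S \<subseteq> B" using sub(1) xy arcs verts(2) by blast
    moreover then have "T \<subseteq> A" using sub(1) xy arcs verts(2) by blast
    ultimately show ?thesis by blast
  qed
  then show "H \<in> case_prod biclique ` ?P"
  proof
    assume "S \<subseteq> A \<and> T \<subseteq> B"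
    then have "(S, T) \<in> ?P" using cards sub by (auto simp: bicliques_def)
    then show ?thesis by (force simp: HST)
  next
    assume "S \<subseteq> B \<and> T \<subseteq> A"
    then have "(T, S) \<in> ?P" using cards sub by (auto simp: bicliques_def)
    then show ?thesis by (force simp: HST biclique_commute[of S])
  qed
next
  fix H assume "H \<in> case_prod biclique ` ?P"
  then obtain S T where H: "H = biclique S T" and ST: "(S, T) \<in> ?P" by auto
  have sub: "S \<subseteq> A" "T \<subseteq> B" "S \<times> T \<subseteq> parcs G" using ST by (auto simp: bicliques_def)
  then have sub': "T \<times> S \<subseteq> parcs G" using pair_graph_symD[OF pair_graph_G] by blast
  have dis: "S \<inter> T = {}" "T \<inter> S = {}" using sub verts(2) by auto
  have "card S = s \<and> card T = t \<or> card T = s \<and> card S = t"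
    using ST by (auto simp: bicliques_def)
  then show "H \<in> copies (complete_bip s t) G"
  proof
    assume "card S = s \<and> card T = t"
    then show ?thesis using biclique_in_copies[OF pair_graph_G, of S T s t] sub dis verts assms H by blast
  next
    assume "card T = s \<and> card S = t"
    then show ?thesis using biclique_in_copies[OF pair_graph_G, of T S s t] sub sub' dis verts assms H
      by (metis Un_upper1 Un_upper2 biclique_commute order_trans)
  qed
qed

text \<open>Intersecting the vertex set of a biclique with \<open>A\<close> and \<open>B\<close>
  recovers the pair, so no copy is counted twice. The two orientations give the same family if s = t
  and disjoint families otherwise.\<close>

lemma card_copies_complete_bip:
  assumes "s \<ge> 1" "t \<ge> 1"
  shows "card (copies (complete_bip s t) G) =
    (if s \<noteq> t then card (bicliques (parcs G) A B s t) + card (bicliques (parcs G) A B t s)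
     else card (bicliques (parcs G) A B s t))"
proof -
  let ?P = "bicliques (parcs G) A B s t \<union> bicliques (parcs G) A B t s"
  have "inj_on (case_prod biclique) ?P"
  proof (rule inj_on_inverseI[of _ "\<lambda>H. (pverts H \<inter> A, pverts H \<inter> B)"])
    fix p assume "p \<in> ?P"
    then show "(pverts (case_prod biclique p) \<inter> A, pverts (case_prod biclique p) \<inter> B) = p"
      using verts(2) by (auto simp: bicliques_def biclique_def)
  qed
  then show ?thesis
    using card_Un_disjoint[OF finite_bicliques[OF finite_parts] finite_bicliques[OF finite_parts] bicliques_disjoint]
    by (simp add: copies_complete_bip[OF assms] card_image)
qed

lemma matching_copyI:
  assumes M: "M \<subseteq> parcs G \<inter> A \<times> B" "inj_on fst M" "inj_on snd M" "card M = m"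
  shows "copies (matching_graph m) G \<noteq> {}"
proof -
  have "finite M" using M(1) finite_parts by (meson finite_Int finite_SigmaI finite_subset)
  then obtain h where h: "bij_betw h {..<m} M"
    using ex_bij_betw_nat_finite[of M] M(4) by (auto simp: atLeast0LessThan)
  \<comment> \<open>The Boolean selects the class, so vertices with different Booleans have
    different images because \<open>A\<close> and \<open>B\<close> are disjoint.\<close>
  define f where "f = (\<lambda>(i, b). if b then snd (h i) else fst (h i))"
  have hM: "h i \<in> M" if "i < m" for i using h that by (auto simp: bij_betw_def)
  have hAB: "fst (h i) \<in> A" "snd (h i) \<in> B" "h i \<in> parcs G" if "i < m" for i
    using hM[OF that] M(1) by (auto simp: mem_Times_iff)
  have i1: "i = j" if "i < m" "j < m" "fst (h i) = fst (h j)" for i j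
    using h M(2) that hM by (metis bij_betw_def inj_onD lessThan_iff)
  have i2: "i = j" if "i < m" "j < m" "snd (h i) = snd (h j)" for i j
    using h M(3) that hM by (metis bij_betw_def inj_onD lessThan_iff)
  have ne: "fst (h i) \<noteq> snd (h j)" if "i < m" "j < m" for i j
    using hAB(1)[OF that(1)] hAB(2)[OF that(2)] verts(2) by auto
  have "inj_on f (pverts (matching_graph m))"
    using i1 i2 ne by (auto simp: inj_on_def f_def matching_graph_def dest: not_sym split: if_splits)
      (metis ne)+
  moreover have "f ` pverts (matching_graph m) \<subseteq> pverts G"
    using hAB verts(1) by (auto simp: f_def matching_graph_def)
  moreover have "map_prod f f ` parcs (matching_graph m) \<subseteq> parcs G"
    using hAB(3) pair_graph_symD[OF pair_graph_G]
    by (auto simp: f_def matching_graph_def)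
  ultimately show ?thesis
    using in_copies_iff[OF pair_graph_imp_wf[OF pair_graph_matching_graph] pair_graph_imp_wf[OF pair_graph_G]]
    by blast
qed

text \<open>Contrapositive of Koenig's theorem, applied to the arcs from \<open>A\<close> to
  \<open>B\<close> so that each edge occurs only once.\<close>

lemma matching_free_cover:
  assumes "copies (matching_graph (Suc k)) G = {}"
  obtains X Y where "finite X" "finite Y" "parcs G \<inter> A \<times> B \<subseteq> X \<times> UNIV \<union> UNIV \<times> Y" "card X + card Y \<le> k"
proof -
  have fin: "finite (parcs G \<inter> A \<times> B)" using finite_parts by auto
  have "\<not> (\<exists>M\<subseteq>parcs G \<inter> A \<times> B. inj_on fst M \<and> inj_on snd M \<and> card M = Suc k)"
    using matching_copyI[of _ "Suc k"] assms by blast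
  then have "\<exists>X Y. is_cover (parcs G \<inter> A \<times> B) X Y \<and> \<not> Suc k \<le> card X + card Y"
    using koenig[OF fin, of "Suc k"] by blast
  then show ?thesis using that by (auto simp: is_cover_def not_le less_Suc_eq_le)
qed

end

text \<open>The edges of a matching are disjoint, so each uses up its own vertex of
  \<open>C\<close>.\<close>

lemma matching_free_if_cover:
  assumes G: "pair_graph G" and C: "finite C" "card C < m"
    and cover: "\<And>x y. (x, y) \<in> parcs G \<Longrightarrow> x \<in> C \<or> y \<in> C"
  shows "copies (matching_graph m) G = {}"
proof (rule ccontr)
  assume "copies (matching_graph m) G \<noteq> {}"
  then obtain f where f: "inj_on f (pverts (matching_graph m))"
    "map_prod f f ` parcs (matching_graph m) \<subseteq> parcs G"
    using in_copies_iff[OF pair_graph_imp_wf[OF pair_graph_matching_graph] pair_graph_imp_wf[OF G]]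
    by blast
  have "\<exists>b. f (i, b) \<in> C" if "i < m" for i
  proof -
    have "(f (i, False), f (i, True)) \<in> parcs G"
      using f(2) that by (force simp: matching_graph_def)
    then show ?thesis using cover by blast
  qed
  then obtain b where b: "\<And>i. i < m \<Longrightarrow> f (i, b i) \<in> C" by metis
  have "inj_on (\<lambda>i. f (i, b i)) {..<m}"
    using f(1) by (auto simp: inj_on_def matching_graph_def)
  then have "card {..<m} \<le> card C"
    using b C(1) by (intro card_inj_on_le) auto
  then show False using C(2) by simp
qed

section \<open>Counting\<close>

text \<open>The summands on the left are the two extreme terms of Vandermonde's sum for
  \<open>a + b choose s\<close>. They are distinct terms because s is positive; for s = 0 the
  inequality would read 2 \<le> 1.\<close>

lemma binomial_add_le:
  assumes "s \<ge> 1" "a + b \<le> k"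
  shows "(a choose s) + (b choose s) \<le> (k choose s)"
proof -
  have "(a choose s) + (b choose s) = (\<Sum>i\<in>{0, s}. (a choose i) * (b choose (s - i)))"
    using assms(1) by simp
  also have "\<dots> \<le> (\<Sum>i\<le>s. (a choose i) * (b choose (s - i)))"
    by (rule sum_mono2) auto
  also have "\<dots> = (a + b choose s)" by (rule vandermonde)
  also have "\<dots> \<le> (k choose s)" using assms(2) by (rule binomial_right_mono)
  finally show ?thesis .
qed

text \<open>A pair with both \<open>S \<subseteq> X\<close> and \<open>T \<subseteq> Y\<close> is
  counted twice, which is harmless for an upper bound.\<close>

lemma card_bicliques_le:
  assumes fin: "finite A" "finite B" "finite X" "finite Y"
    and cov: "E \<inter> A \<times> B \<subseteq> X \<times> UNIV \<union> UNIV \<times> Y"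
  shows "card (bicliques E A B s t) \<le>
    (card X choose s) * (card B choose t) + (card A choose s) * (card Y choose t)"
proof -
  let ?K = "\<lambda>Z r. {S. S \<subseteq> Z \<and> card S = r}"
  have "bicliques E A B s t \<subseteq> ?K X s \<times> ?K B t \<union> ?K A s \<times> ?K Y t"
  proof (rule subrelI)
    fix S T assume st: "(S, T) \<in> bicliques E A B s t"
    then have *: "S \<subseteq> A" "T \<subseteq> B" "card S = s" "card T = t" "S \<times> T \<subseteq> E \<inter> A \<times> B"
      by (auto simp: bicliques_def)
    then have "S \<subseteq> X \<or> T \<subseteq> Y" using cov by blast
    then show "(S, T) \<in> ?K X s \<times> ?K B t \<union> ?K A s \<times> ?K Y t" using * by auto
  qed
  then have "card (bicliques E A B s t) \<le> card (?K X s \<times> ?K B t \<union> ?K A s \<times> ?K Y t)"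
    using fin by (intro card_mono) auto
  also have "\<dots> \<le> card (?K X s \<times> ?K B t) + card (?K A s \<times> ?K Y t)"
    by (rule card_Un_le)
  finally show ?thesis using fin by (simp add: card_cartesian_product n_subsets)
qed

section \<open>The upper bound\<close>

lemma copies_le:
  assumes G: "balanced_bipartite n G" "copies (matching_graph (k + 1)) G = {}"
    and st: "s \<ge> 1" "t \<ge> 1"
  shows "card (copies (complete_bip s t) G) \<le>
    (if s \<noteq> t then (k choose s) * (n choose t) + (k choose t) * (n choose s)
     else (k choose s) * (n choose s))"
proof -
  obtain A B where AB: "bipartite_host G A B" "card A = n" "card B = n"
    using G(1) by (auto simp: balanced_bipartite_def bipartite_host_def)
  interpret bipartite_host G A B by fact
  obtain X Y where XY: "finite X" "finite Y" "parcs G \<inter> A \<times> B \<subseteq> X \<times> UNIV \<union> UNIV \<times> Y"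
    and k: "card X + card Y \<le> k"
    using matching_free_cover G(2) by auto
  let ?a = "card X" and ?b = "card Y"
  have N: "card (bicliques (parcs G) A B u v) \<le> (?a choose u) * (n choose v) + (n choose u) * (?b choose v)"
    for u v using card_bicliques_le[OF finite_parts XY] AB by simp
  \<comment> \<open>For s \<noteq> t the bounds \<open>N s t\<close> and \<open>N t s\<close> are
    added and regrouped by the factors \<open>n choose t\<close> and \<open>n choose s\<close>,
    which brings these sums together; for s = t the single bound \<open>N s s\<close> already
    factors this way.\<close>
  have s: "((?a choose s) + (?b choose s)) * (n choose v) \<le> (k choose s) * (n choose v)"
    and t: "((?a choose t) + (?b choose t)) * (n choose v) \<le> (k choose t) * (n choose v)" for v
    using binomial_add_le st k by simp_all
  show ?thesis
    unfolding card_copies_complete_bip[OF st]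
    using N[of s t] N[of t s] s[of t] t[of s]
    by (cases "s = t") (simp_all add: algebra_simps)
qed

section \<open>The extremal graph: K_{k,n} padded with n - k isolated vertices\<close>

definition extremal_graph :: "nat \<Rightarrow> nat \<Rightarrow> nat pair_pre_digraph" where
  "extremal_graph k n =
    \<lparr>pverts = {..<n} \<union> {n..<2 * n}, parcs = {..<k} \<times> {n..<2 * n} \<union> {n..<2 * n} \<times> {..<k}\<rparr>"

lemma bipartite_host_extremal_graph:
  assumes "k \<le> n"
  shows "bipartite_host (extremal_graph k n) {..<n} {n..<2 * n}"
proof
  show "symmetric (with_proj (extremal_graph k n))"
    by (auto simp: symmetric_def extremal_graph_def intro!: symI)
qed (use assms in \<open>auto simp: extremal_graph_def\<close>)

lemma card_bicliques_extremal_graph: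
  assumes "k \<le> n" "s \<ge> 1" "t \<ge> 1"
  shows "card (bicliques (parcs (extremal_graph k n)) {..<n} {n..<2 * n} s t) =
    (k choose s) * (n choose t)"
proof -
  let ?K = "\<lambda>Z r. {S. S \<subseteq> Z \<and> card S = r}"
  have "bicliques (parcs (extremal_graph k n)) {..<n} {n..<2 * n} s t = ?K {..<k} s \<times> ?K {n..<2 * n} t"
  proof (intro equalityI subsetI)
    fix p assume "p \<in> bicliques (parcs (extremal_graph k n)) {..<n} {n..<2 * n} s t"
    then obtain S T where p: "p = (S, T)" "S \<subseteq> {..<n}" "T \<subseteq> {n..<2 * n}" "card S = s" "card T = t"
      and sub: "S \<times> T \<subseteq> {..<k} \<times> {n..<2 * n} \<union> {n..<2 * n} \<times> {..<k}"
      by (auto simp: bicliques_def extremal_graph_def)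
    \<comment> \<open>All of \<open>S\<close> is adjacent to \<open>y\<close>, whose neighbours are
      the first \<open>k\<close> vertices. With empty \<open>T\<close>, the set \<open>S\<close>
      could contain isolated vertices.\<close>
    obtain y where "y \<in> T" using p(5) assms(3) by (metis all_not_in_conv card.empty not_one_le_zero)
    then have "S \<subseteq> {..<k}" using sub p(2,3) by fastforce
    then show "p \<in> ?K {..<k} s \<times> ?K {n..<2 * n} t" using p by simp
  next
    fix p assume "p \<in> ?K {..<k} s \<times> ?K {n..<2 * n} t"
    then show "p \<in> bicliques (parcs (extremal_graph k n)) {..<n} {n..<2 * n} s t"
      using assms(1) by (fastforce simp: bicliques_def extremal_graph_def)
  qed
  then show ?thesis by (simp add: card_cartesian_product n_subsets)
qed

theorem theorem1p4:
  fixes k s t n :: nat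
  assumes "k \<ge> 1" and "s \<ge> 1" and "t \<ge> 1" and "n \<ge> k"
  shows "ex_bip n (complete_bip s t) (matching_graph (k + 1)) =
    (if s \<noteq> t then (k choose s) * (n choose t) + (k choose t) * (n choose s)
     else (k choose s) * (n choose s))"
    (is "_ = ?r")
proof -
  let ?G = "extremal_graph k n"
  let ?V = "{card (copies (complete_bip s t) G) | G :: nat pair_pre_digraph.
    balanced_bipartite n G \<and> copies (matching_graph (k + 1)) G = {}}"
  interpret bipartite_host ?G "{..<n}" "{n..<2 * n}"
    using assms(4) by (rule bipartite_host_extremal_graph)
  have le: "v \<le> ?r" if "v \<in> ?V" for v
    using that
  proof (elim CollectE exE conjE)
    fix G :: "nat pair_pre_digraph"
    assume "v = card (copies (complete_bip s t) G)"
      "balanced_bipartite n G" "copies (matching_graph (k + 1)) G = {}"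
    then show "v \<le> ?r" using copies_le[OF _ _ assms(2,3), of n G k] by simp
  qed
  have "balanced_bipartite n ?G"
    unfolding balanced_bipartite_def using pair_graph_G verts arcs
    by (intro conjI exI[of _ "{..<n}"] exI[of _ "{n..<2 * n}"]) auto
  moreover have "copies (matching_graph (k + 1)) ?G = {}"
    \<comment> \<open>These \<open>k\<close> vertices meet every edge, one fewer than the matching
      has edges.\<close>
    by (rule matching_free_if_cover[OF pair_graph_G, of "{..<k}"]) (auto simp: extremal_graph_def)
  moreover have "?r = card (copies (complete_bip s t) ?G)"
    unfolding card_copies_complete_bip[OF assms(2,3)]
    using card_bicliques_extremal_graph[OF assms(4,2,3)] card_bicliques_extremal_graph[OF assms(4,3,2)]
    by (auto simp del: One_nat_def)
  ultimately have "?r \<in> ?V" by (intro CollectI exI conjI)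
  \<comment> \<open>Infinitely many graphs on \<open>nat\<close> compete, so the finiteness that
    \<open>Max\<close> requires comes from the bound on the values.\<close>
  moreover have "finite ?V" unfolding finite_nat_set_iff_bounded_le using le by (intro exI ballI)
  ultimately show ?thesis unfolding ex_bip_def by (intro Max_eqI le)
qed

end
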